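(* Let $G$ be a finite, simple, undirected, connected graph and let $v$ be a simplicial vertex in $G$. If $G-v$ is a distance preserving graph, then $G$ is distance preserving.
   Context: All graphs are finite, undirected, simple, and connected. $\mathcal{N}(v)$ denotes the neighborhood of $v$, i.e. the set of vertices adjacent to $v$ in $G$. For $A\subseteq V(G)$, $G[A]$ denotes the subgraph of $G$ induced by $A$, and $G-v=G[V(G)\setminus\{v\}]$. A vertex $v\in V(G)$ is called simplicial if $G[\mathcal{N}(v)]$ is a clique (complete graph). The distance $d_G(u,v)$ is the minimal length (number of edges) of a path in $G$ connecting $u$ and $v$. An induced subgraph $H$ of $G$ is called an isometric subgraph of $G$ if $d_H(a,b)=d_G(a,b)$ for every pair of vertices $a,b\in V(H)$ (in particular, since $G$ is connected, an isometric subgraph is connected). A connected graph $G$ is called distance preserving (dp) if and only if it has an isometric subgraph with exactly $i$ vertices for every $1\le i\le |V(G)|$. *)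

theory Defs
  imports "Graph_Theory.Graph_Theory"
begin

text \<open>
  Finite simple undirected graphs are the locale \<^locale>\<open>graph\<close>: finite symmetric digraphs without
  loops and without parallel arcs, an edge being a pair of opposite arcs.
\<close>

definition neighborhood :: "('a, 'b) pre_digraph \<Rightarrow> 'a \<Rightarrow> 'a set" where
  "neighborhood G v = {u. v \<rightarrow>\<^bsub>G\<^esub> u}"

definition clique :: "('a, 'b) pre_digraph \<Rightarrow> bool" where
  "clique G \<longleftrightarrow> complete_digraph (card (verts G)) G"

definition simplicial :: "('a, 'b) pre_digraph \<Rightarrow> 'a \<Rightarrow> bool" where
  "simplicial G v \<longleftrightarrow> v \<in> verts G \<and> clique (G \<restriction> neighborhood G v)"

text \<open>
  The library's shortest-path distance with unit weights. It is an infimum over walks rather than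
  paths, which agrees by \<open>gdist_eq_path\<close> below, and it is \<open>\<infinity>\<close> if there is no path.
\<close>

definition gdist :: "('a, 'b) pre_digraph \<Rightarrow> 'a \<Rightarrow> 'a \<Rightarrow> ereal" where
  "gdist G u v = wf_digraph.\<mu> G (\<lambda>_. 1) u v"

lemma gdist_eq_path:
  assumes "fin_digraph G"
  shows "gdist G u v = (INF p\<in>{p. pre_digraph.apath G u p v}. ereal (real (length p)))"
proof -
  interpret fin_digraph G by fact
  have cost: "awalk_cost (\<lambda>_. 1) p = real (length p)" for p :: "'b list"
    by (induct p) auto
  show ?thesis
    unfolding gdist_def \<mu>_def cost
  proof (rule antisym)
    show "(INF p\<in>{p. awalk u p v}. ereal (real (length p)))
        \<le> (INF p\<in>{p. apath u p v}. ereal (real (length p)))"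
      by (rule INF_superset_mono) (auto intro: awalkI_apath)
    have "\<exists>q. apath u q v \<and> length q \<le> length p" if "awalk u p v" for p
      using apath_awalk_to_apath[OF that] awalk_to_path_no_neg_cyc_cost[OF that, of "\<lambda>_. 1"]
      by (auto simp: cost)
    then show "(INF p\<in>{p. apath u p v}. ereal (real (length p)))
        \<le> (INF p\<in>{p. awalk u p v}. ereal (real (length p)))"
      by (intro INF_mono) auto
  qed
qed

definition isometric_subgraph :: "('a, 'b) pre_digraph \<Rightarrow> ('a, 'b) pre_digraph \<Rightarrow> bool" where
  "isometric_subgraph H G \<longleftrightarrow>
    induced_subgraph H G \<and> (\<forall>a \<in> verts H. \<forall>b \<in> verts H. gdist H a b = gdist G a b)"

text \<open>
  Connectedness is part of the definition; as \<^const>\<open>connected\<close> excludes the graph without vertices,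
  that graph is not distance preserving.
\<close>

definition distance_preserving :: "('a, 'b) pre_digraph \<Rightarrow> bool" where
  "distance_preserving G \<longleftrightarrow>
    connected G \<and>
    (\<forall>i. 1 \<le> i \<and> i \<le> card (verts G) \<longrightarrow> (\<exists>H. isometric_subgraph H G \<and> card (verts H) = i))"

end

theory Submission
  imports Defs
begin

text \<open>
  A walk through a simplicial vertex \<open>v\<close> with both ends different from \<open>v\<close> can be shortened: the
  vertices before and after a visit to \<open>v\<close> are neighbours of \<open>v\<close>, hence equal or adjacent. So
  \<open>G - v\<close> is isometric in \<open>G\<close>, its isometric subgraphs are isometric in \<open>G\<close> as well, and only the
  size \<open>|V(G)|\<close> remains, for which \<open>G\<close> itself serves.
\<close>

text \<open>Turns comparing distances into comparing infima over walks, so walks never have to be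
  made into paths.\<close>

lemma (in wf_digraph) gdist_eq_awalk:
  "gdist G u v = (INF p\<in>{p. awalk u p v}. ereal (real (length p)))"
proof -
  have "awalk_cost (\<lambda>_. 1) p = real (length p)" for p :: "'b list"
    by (induct p) auto
  then show ?thesis
    by (simp add: gdist_def \<mu>_def)
qed

lemma isometric_subgraph_refl: "wf_digraph G \<Longrightarrow> isometric_subgraph G G"
  by (simp add: isometric_subgraph_def wf_digraph.induced_subgraph_refl)

lemma isometric_subgraph_trans:
  assumes "isometric_subgraph H K" and "isometric_subgraph K G"
  shows "isometric_subgraph H G"
proof -
  have HK: "induced_subgraph H K" and KG: "induced_subgraph K G"
    using assms by (auto simp: isometric_subgraph_def)
  have sub: "subgraph H G" "verts H \<subseteq> verts K"
    using HK KG subgraph_trans by blast+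
  \<comment> \<open>\<open>K\<close> and \<open>G\<close> share their endpoint maps by
    compatibility, so the arc set of \<open>H\<close>, described through \<open>K\<close>, can be
    read in \<open>G\<close>.\<close>
  have ends: "tail K = tail G" "head K = head G"
    using KG by (auto simp: induced_subgraph_def subgraph_def compatible_def)
  have "arcs H = {e \<in> arcs G. tail G e \<in> verts H \<and> head G e \<in> verts H}"
    using HK KG sub(2) by (auto simp: induced_subgraph_def ends)
  with sub have "induced_subgraph H G"
    by (simp add: induced_subgraph_def)
  then show ?thesis
    using assms sub(2) by (simp add: isometric_subgraph_def subset_iff)
qed

lemma simplicial_adj:
  assumes "simplicial G v" "v \<rightarrow>\<^bsub>G\<^esub> a" "v \<rightarrow>\<^bsub>G\<^esub> b" "a \<noteq> b"
  shows "a \<rightarrow>\<^bsub>G\<^esub> b"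
proof -
  have "(a, b) \<in> arcs_ends (G \<restriction> neighborhood G v)"
    using assms by (auto simp: simplicial_def clique_def complete_digraph_def neighborhood_def)
  then show ?thesis
    by (rule dominates_induce_subgraphD)
qed

context graph
begin

text \<open>Strong induction on length, because removing a visit to \<open>v\<close> consumes two
  arcs at once. The start \<open>a\<close> varies while the end \<open>b\<close> stays
  fixed.\<close>

lemma awalk_avoid_simplicial:
  assumes "simplicial G v" "awalk a p b" "a \<noteq> v" "b \<noteq> v"
  shows "\<exists>q. pre_digraph.awalk (G \<restriction> (verts G - {v})) a q b \<and> length q \<le> length p"
  using assms(2,3)
proof (induction p arbitrary: a rule: length_induct)
  case (1 p)
  define H where "H = G \<restriction> (verts G - {v})"
  interpret H: wf_digraph H
    unfolding H_def ..
  have IH: "\<exists>q. H.awalk w q b \<and> length q \<le> length r"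
    if "length r < length p" "awalk w r b" "w \<noteq> v" for w r
    using 1(1) that by (simp add: H_def)
  \<comment> \<open>Prepends one arc to a walk in \<open>H\<close>; it serves both for keeping the
    first arc and for inserting the shortcut past \<open>v\<close>.\<close>
  have step: "\<exists>q. H.awalk a q b \<and> length q \<le> Suc n"
    if w: "a \<rightarrow>\<^bsub>G\<^esub> w" "w \<noteq> v" "H.awalk w q b" "length q \<le> n" for w q n
  proof -
    \<comment> \<open>Despite its name, \<open>reachableE\<close> here extracts an arc from a single
      adjacency.\<close>
    obtain e where "e \<in> arcs G" "tail G e = a" "head G e = w"
      using w(1) by (rule reachableE)
    with w(2) 1 have "e \<in> arcs H" "tail H e = a" "head H e = w"
      by (auto simp: H_def)
    with w(3) have "H.awalk a (e # q) b"
      by (simp add: H.awalk_Cons_iff)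
    with w show ?thesis
      by (intro exI[of _ "e # q"]) simp
  qed
  show ?case
    unfolding H_def[symmetric]
  proof (cases p)
    case Nil
    with 1 have "a = b" "a \<in> verts H"
      by (auto simp: awalk_Nil_iff H_def)
    then have "H.awalk a [] b"
      by (simp add: H.awalk_Nil_iff)
    then show "\<exists>q. H.awalk a q b \<and> length q \<le> length p"
      by (intro exI[of _ "[]"]) simp
  next
    case (Cons e p')
    with 1 have e: "a \<rightarrow>\<^bsub>G\<^esub> head G e" and p': "awalk (head G e) p' b"
      by (auto simp: awalk_Cons_iff intro: in_arcs_imp_in_arcs_ends)
    show "\<exists>q. H.awalk a q b \<and> length q \<le> length p"
    proof (cases "head G e = v")
      case False
      have "length p' < length p"
        using Cons by simp
      with p' False obtain q where "H.awalk (head G e) q b" "length q \<le> length p'"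
        using IH by blast
      then show ?thesis
        using step[OF e False] Cons by simp
    next
      case True
      \<comment> \<open>The walk cannot stop at \<open>v\<close> since \<open>b \<noteq> v\<close>,
        so a second arc \<open>f\<close> leaves \<open>v\<close>.\<close>
      then obtain f p'' where f: "p' = f # p''"
        using p' \<open>b \<noteq> v\<close> by (cases p') (auto simp: awalk_Nil_iff)
      with p' True have vf: "v \<rightarrow>\<^bsub>G\<^esub> head G f" and p'': "awalk (head G f) p'' b"
        by (auto simp: awalk_Cons_iff intro: in_arcs_imp_in_arcs_ends)
      have nv: "head G f \<noteq> v"
        using vf adj_not_same by blast
      have "length p'' < length p"
        using Cons f by simp
      with p'' nv obtain q where q: "H.awalk (head G f) q b" "length q \<le> length p''"
        using IH by blast
      show ?thesis
      \<comment> \<open>Either the walk returns to \<open>a\<close> and the detour is dropped, or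
        one arc between two neighbours of \<open>v\<close> replaces the two arcs through
        \<open>v\<close>.\<close>
      proof (cases "a = head G f")
        case True
        with q Cons f show ?thesis
          by (intro exI[of _ q]) simp
      next
        case False
        have "v \<rightarrow>\<^bsub>G\<^esub> a"
          using graph_symmetric[OF e] True by simp
        then have "a \<rightarrow>\<^bsub>G\<^esub> head G f"
          using simplicial_adj[OF assms(1)] vf False by simp
        then obtain r where "H.awalk a r b" "length r \<le> Suc (length p'')"
          using step[OF _ nv q] by blast
        then show ?thesis
          using Cons f by (intro exI[of _ r]) simp
      qed
    qed
  qed
qed

lemma isometric_subgraph_delete_simplicial:
  assumes "simplicial G v"
  shows "isometric_subgraph (G \<restriction> (verts G - {v})) G"
proof -
  define H where "H = G \<restriction> (verts G - {v})"
  interpret H: wf_digraph H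
    unfolding H_def ..
  have ind: "induced_subgraph H G"
    unfolding H_def by (rule induced_induce) auto
  have "gdist H a b = gdist G a b" if "a \<in> verts H" "b \<in> verts H" for a b
  proof (rule antisym)
    have "a \<noteq> v" "b \<noteq> v"
      using that by (auto simp: H_def)
    \<comment> \<open>Every walk in \<open>G\<close> is matched by a walk in \<open>H\<close> that
      is no longer.\<close>
    then show "gdist H a b \<le> gdist G a b"
      unfolding gdist_eq_awalk H.gdist_eq_awalk
      using awalk_avoid_simplicial[OF assms] by (intro INF_mono) (auto simp: H_def)
    \<comment> \<open>Walks in \<open>H\<close> are walks in \<open>G\<close>, so the infimum for
      \<open>G\<close> ranges over a larger set.\<close>
    show "gdist G a b \<le> gdist H a b"
      unfolding gdist_eq_awalk H.gdist_eq_awalk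
      using ind subgraph_awalk_imp_awalk by (intro INF_superset_mono) auto
  qed
  with ind show ?thesis
    by (simp add: isometric_subgraph_def H_def)
qed

end

theorem lemma3p1:
  fixes G :: "('a, 'b) pre_digraph" and v :: 'a
  assumes "graph G" and "connected G"
    and "simplicial G v"
    and "distance_preserving (G \<restriction> (verts G - {v}))"
  shows "distance_preserving G"
proof -
  interpret graph G by fact
  have "\<exists>H. isometric_subgraph H G \<and> card (verts H) = i"
    if "1 \<le> i" "i \<le> card (verts G)" for i
  proof (cases "i = card (verts G)")
    case True
    then show ?thesis
      using isometric_subgraph_refl wf_digraph_axioms by blast
  next
    case False
    have "v \<in> verts G"
      using assms(3) by (simp add: simplicial_def)
    \<comment> \<open>Deleting \<open>v\<close> lowers the number of vertices by exactly one, which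
      leaves room for every \<open>i\<close> below \<open>card (verts G)\<close>.\<close>
    with False that have "i \<le> card (verts (G \<restriction> (verts G - {v})))"
      by simp
    with assms(4) that(1) obtain H
      where "isometric_subgraph H (G \<restriction> (verts G - {v}))" "card (verts H) = i"
      unfolding distance_preserving_def by blast
    then show ?thesis
      using isometric_subgraph_trans isometric_subgraph_delete_simplicial[OF assms(3)] by blast
  qed
  with assms(2) show ?thesis
    by (simp add: distance_preserving_def)
qed

end
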